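(* Let $U:=H^{r+1/2}_{0,\sigma}(0,T;\mathbb{R}^P)$ be the space of intensity control parameters, $X:=(H^1(0,T))^M$ and $Y:=L^2(0,T;\mathbb{R}^M)$. For $p\in U$ let $F=F(p)$ be the forcing vector, $\sigma$ the amplitude vector, $r$ the remainder and $G$ the effective heat input of the thermo-plasmonic model with particle size $\delta$, as described in the context, so that $\sigma=\mathcal V F+r$ and $G_i=\frac{\alpha_i}{c_m}\sigma_i$ for $i=1,\dots,M$. Assume that: (i) the map $p\mapsto F(p)$ associated with the Maxwell problem and the forcing term in the Volterra system extends to a bounded linear operator $\mathcal T:U\to X$; (ii) the Volterra system defines a bounded linear operator $\mathcal V\in\mathcal L(X,X)$, and the remainder $r\in X$ satisfies $\|r\|_X\le C_T M\delta^\mu\|F\|_X$ for some $\mu>0$ and $C_T>0$ independent of $\delta$; (iii) the map $\sigma\mapsto G$ given by $G_i=\frac{\alpha_i}{c_m}\sigma_i$ extends to a bounded linear operator $\mathcal S\in\mathcal L(X,Y)$. Then there exist a bounded linear operator $\mathcal K:U\to Y$ and a remainder operator $\mathcal R^\delta:U\to Y$ such that, for every $p\in U$, $$G=\mathcal Kp+\mathcal R^\delta p,\qquad\text{with}\qquad \|\mathcal R^\delta p\|_Y\le C_T'M\delta^\mu\|p\|_U,$$ for some constant $C_T'>0$ independent of $\delta$ and $p$.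
   Context: Setting: $T>0$, $M,P\in\mathbb{N}$. $M$ plasmonic nanoparticles $D_i=z_i+\delta B_i\subset\mathbb{R}^3$ of size $\delta\ll1$ (centers $z_i$, bounded $C^2$ reference shapes $B_i$) sit in a homogeneous background with volumetric heat capacity $c_m>0$, thermal conductivity $\gamma_m>0$ and diffusion constant $\kappa_m>0$; $\alpha_i=\gamma_{p,i}-\gamma_m$ is the heat-conductivity contrast, $\gamma_{p,i}$ being the conductivity of the $i$-th particle. The particles are illuminated by incident electromagnetic fields, the total electric field $E$ solving a time-harmonic Maxwell scattering problem. An intensity control $p=(p_\ell)_{\ell=1}^P$ (time-dependent weights of $P$ fixed illumination intensity patterns) produces forcing terms $F=(F_i)_{i=1}^M$, where $F_i$ depends linearly on the internal electromagnetic energy $|E|^2$ in $D_i$, so that $F$ depends linearly on $p$. The amplitudes $\sigma=(\sigma_i)_{i=1}^M$ solve the Volterra integral system $$\sigma_i(t)+\sum_{j\ne i}\beta_{ij}\int_0^t\partial_t\Phi^{(m)}(z_i,t;z_j,\tau)\,\sigma_j(\tau)\,d\tau=F_i(t)+r_i(t),$$ with interaction coefficients $\beta_{ij}$ depending on the geometry and contrast parameters, small remainders $r_i$, and heat kernel $\Phi^{(m)}(x,t;y,\tau)=(4\pi\kappa_m(t-\tau))^{-3/2}\exp\big(-\frac{|x-y|^2}{4\kappa_m(t-\tau)}\big)\chi_{(0,\infty)}(t-\tau)$. In operator form this is written $\sigma=\mathcal VF+r$, where $\mathcal V$ is a bounded Volterra operator on $X$ and $r$ is a small remainder. The effective heat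 inputs associated with the nanoparticles are $G=(G_i)_{i=1}^M$, $G_i(t)=\frac{\alpha_i}{c_m}\sigma_i(t)$. $H^{s}_{0,\sigma}(0,T;\mathbb{R}^P)$ is the Hilbert space of restrictions to $(0,T)$ of causal functions $f$ on $\mathbb{R}$ ($f=0$ for $t<0$) with $e^{-\sigma t}f\in H^s(\mathbb{R};\mathbb{R}^P)$, with the quotient norm (here the subscript $\sigma>0$ is a fixed weight parameter, unrelated to the amplitudes, and $r\ge0$ in the exponent is a fixed regularity index, unrelated to the remainder). *)

theory Defs
  imports "HOL-Analysis.Analysis"
begin

section \<open>Function spaces\<close>

text \<open>
  Elements of the spaces are represented by functions; two representatives denote the same element
  iff they agree almost everywhere on the interval \<open>(0,T)\<close>.
\<close>

definition ae_eq :: "real \<Rightarrow> (real \<Rightarrow> 'b) \<Rightarrow> (real \<Rightarrow> 'b) \<Rightarrow> bool" where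
  "ae_eq T f g \<longleftrightarrow> (AE t in lebesgue_on {0<..<T}. f t = g t)"

definition dir_deriv :: "'a::euclidean_space \<Rightarrow> ('a \<Rightarrow> real) \<Rightarrow> 'a \<Rightarrow> real" where
  "dir_deriv b f x = deriv (\<lambda>h. f (x + h *\<^sub>R b)) 0"

primrec Ck :: "nat \<Rightarrow> ('a::euclidean_space \<Rightarrow> real) \<Rightarrow> bool" where
  "Ck 0 f \<longleftrightarrow> continuous_on UNIV f"
| "Ck (Suc k) f \<longleftrightarrow> (\<forall>x. f differentiable (at x)) \<and> (\<forall>b\<in>Basis. Ck k (dir_deriv b f))"

definition test_functions :: "'a::euclidean_space set \<Rightarrow> ('a \<Rightarrow> real) set" where
  "test_functions \<Omega> =
     {\<phi>. (\<forall>k. Ck k \<phi>) \<and> compact (closure {x. \<phi> x \<noteq> 0}) \<and> closure {x. \<phi> x \<noteq> 0} \<subseteq> \<Omega>}"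

definition L2_space :: "'a::euclidean_space set \<Rightarrow> ('a \<Rightarrow> 'b::euclidean_space) set" where
  "L2_space S = {f \<in> borel_measurable (lebesgue_on S). integrable (lebesgue_on S) (\<lambda>x. (norm (f x))\<^sup>2)}"

definition L2_space_norm :: "'a::euclidean_space set \<Rightarrow> ('a \<Rightarrow> 'b::euclidean_space) \<Rightarrow> real" where
  "L2_space_norm S f = sqrt (LINT x|lebesgue_on S. (norm (f x))\<^sup>2)"

definition weak_deriv :: "real \<Rightarrow> (real \<Rightarrow> real) \<Rightarrow> (real \<Rightarrow> real) \<Rightarrow> bool" where
  "weak_deriv T f g \<longleftrightarrow>
     (\<forall>\<phi>\<in>test_functions {0<..<T}.
        (LINT t|lebesgue_on {0<..<T}. f t * deriv \<phi> t) = - (LINT t|lebesgue_on {0<..<T}. g t * \<phi> t))"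

definition H1_space :: "real \<Rightarrow> (real \<Rightarrow> real) set" where
  "H1_space T = {f \<in> L2_space {0<..<T}. \<exists>g\<in>L2_space {0<..<T}. weak_deriv T f g}"

text \<open>The weak derivative is unique up to a null set, so the choice below is immaterial.\<close>

definition H1_norm :: "real \<Rightarrow> (real \<Rightarrow> real) \<Rightarrow> real" where
  "H1_norm T f =
     sqrt ((L2_space_norm {0<..<T} f)\<^sup>2
       + (L2_space_norm {0<..<T} (SOME g. g \<in> L2_space {0<..<T} \<and> weak_deriv T f g))\<^sup>2)"

definition H1_vec :: "real \<Rightarrow> (real \<Rightarrow> real ^ 'm::finite) set" where
  "H1_vec T = {f. \<forall>i. (\<lambda>t. f t $ i) \<in> H1_space T}"

definition H1_vec_norm :: "real \<Rightarrow> (real \<Rightarrow> real ^ 'm::finite) \<Rightarrow> real" where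
  "H1_vec_norm T f = sqrt (\<Sum>i\<in>UNIV. (H1_norm T (\<lambda>t. f t $ i))\<^sup>2)"

text \<open>
  Fourier--Plancherel transform on \<open>L\<^sup>2(\<real>)\<close>: the limit in \<open>L\<^sup>2\<close> of the truncated transforms
  \<open>(2\<pi>)\<^sup>-\<^sup>1\<^sup>/\<^sup>2 \<integral>\<^sub>-\<^sub>N\<^sup>N e\<^sup>-\<^sup>i\<^sup>\<xi>\<^sup>t f(t) dt\<close>.  By Plancherel's theorem it exists and is unique up to a null set.
\<close>

definition is_fourier_L2 :: "(real \<Rightarrow> complex) \<Rightarrow> (real \<Rightarrow> complex) \<Rightarrow> bool" where
  "is_fourier_L2 f h \<longleftrightarrow> h \<in> L2_space UNIV \<and>
     (\<lambda>N::nat. \<integral>\<^sup>+\<xi>. ennreal ((cmod (h \<xi> - complex_of_real (1 / sqrt (2 * pi)) *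
          (LINT t:{- real N..real N}|lebesgue. exp (- \<i> * complex_of_real (\<xi> * t)) * f t)))\<^sup>2) \<partial>lebesgue)
       \<longlonglongrightarrow> 0"

definition fourier_L2 :: "(real \<Rightarrow> complex) \<Rightarrow> real \<Rightarrow> complex" where
  "fourier_L2 f = (SOME h. is_fourier_L2 f h)"

text \<open>
  Sobolev space \<open>H\<^sup>s(\<real>; \<real>\<^sup>P)\<close> for real \<open>s \<ge> 0\<close>, componentwise by means of the Fourier transform.
\<close>

definition Hs_space :: "real \<Rightarrow> (real \<Rightarrow> real ^ 'p::finite) set" where
  "Hs_space s = {g. \<forall>l. (\<lambda>t. g t $ l) \<in> L2_space UNIV \<and>
     (\<exists>h. is_fourier_L2 (\<lambda>t. complex_of_real (g t $ l)) h \<and>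
          integrable lebesgue (\<lambda>\<xi>. (1 + \<xi>\<^sup>2) powr s * (cmod (h \<xi>))\<^sup>2))}"

definition Hs_norm :: "real \<Rightarrow> (real \<Rightarrow> real ^ 'p::finite) \<Rightarrow> real" where
  "Hs_norm s g = sqrt (\<Sum>l\<in>UNIV. LINT \<xi>|lebesgue.
     (1 + \<xi>\<^sup>2) powr s * (cmod (fourier_L2 (\<lambda>t. complex_of_real (g t $ l)) \<xi>))\<^sup>2)"

text \<open>
  The space \<open>H\<^sup>s\<close> of causal functions with exponential weight \<open>w\<close>, restricted to \<open>(0,T)\<close>, with its
  quotient norm.
\<close>

definition causal_extensions ::
    "real \<Rightarrow> real \<Rightarrow> real \<Rightarrow> (real \<Rightarrow> real ^ 'p::finite) \<Rightarrow> (real \<Rightarrow> real ^ 'p) set" where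
  "causal_extensions s w T f = {g. (AE t in lebesgue_on {..<0}. g t = 0) \<and> ae_eq T f g \<and>
     (\<lambda>t. exp (- w * t) *\<^sub>R g t) \<in> Hs_space s}"

definition H0_space :: "real \<Rightarrow> real \<Rightarrow> real \<Rightarrow> (real \<Rightarrow> real ^ 'p::finite) set" where
  "H0_space s w T = {f. causal_extensions s w T f \<noteq> {}}"

definition H0_norm :: "real \<Rightarrow> real \<Rightarrow> real \<Rightarrow> (real \<Rightarrow> real ^ 'p::finite) \<Rightarrow> real" where
  "H0_norm s w T f = (INF g\<in>causal_extensions s w T f. Hs_norm s (\<lambda>t. exp (- w * t) *\<^sub>R g t))"

section \<open>Operators between spaces of almost-everywhere classes\<close>

definition class_map ::
    "real \<Rightarrow> (real \<Rightarrow> 'a) set \<Rightarrow> (real \<Rightarrow> 'b) set \<Rightarrow> ((real \<Rightarrow> 'a) \<Rightarrow> (real \<Rightarrow> 'b)) \<Rightarrow> bool" where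
  "class_map T A B L \<longleftrightarrow> (\<forall>x\<in>A. L x \<in> B) \<and> (\<forall>x\<in>A. \<forall>y\<in>A. ae_eq T x y \<longrightarrow> ae_eq T (L x) (L y))"

definition linear_class_map ::
    "real \<Rightarrow> (real \<Rightarrow> 'a::real_vector) set \<Rightarrow> (real \<Rightarrow> 'b::real_vector) set \<Rightarrow>
     ((real \<Rightarrow> 'a) \<Rightarrow> (real \<Rightarrow> 'b)) \<Rightarrow> bool" where
  "linear_class_map T A B L \<longleftrightarrow> class_map T A B L \<and>
     (\<forall>x\<in>A. \<forall>y\<in>A. ae_eq T (L (\<lambda>t. x t + y t)) (\<lambda>t. L x t + L y t)) \<and>
     (\<forall>c. \<forall>x\<in>A. ae_eq T (L (\<lambda>t. c *\<^sub>R x t)) (\<lambda>t. c *\<^sub>R L x t))"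

definition bounded_linear_op ::
    "real \<Rightarrow> (real \<Rightarrow> 'a::real_vector) set \<Rightarrow> ((real \<Rightarrow> 'a) \<Rightarrow> real) \<Rightarrow>
     (real \<Rightarrow> 'b::real_vector) set \<Rightarrow> ((real \<Rightarrow> 'b) \<Rightarrow> real) \<Rightarrow> ((real \<Rightarrow> 'a) \<Rightarrow> (real \<Rightarrow> 'b)) \<Rightarrow> bool" where
  "bounded_linear_op T A nA B nB L \<longleftrightarrow>
     linear_class_map T A B L \<and> (\<exists>C. \<forall>x\<in>A. nB (L x) \<le> C * nA x)"

text \<open>
  A family of bounded linear operators indexed by the particle size, with a bound that does not
  depend on the size.  For a family that does not vary with the size this is just boundedness.
\<close>

definition unif_bounded_linear_ops ::
    "real set \<Rightarrow> real \<Rightarrow> (real \<Rightarrow> 'a::real_vector) set \<Rightarrow> ((real \<Rightarrow> 'a) \<Rightarrow> real) \<Rightarrow>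
     (real \<Rightarrow> 'b::real_vector) set \<Rightarrow> ((real \<Rightarrow> 'b) \<Rightarrow> real) \<Rightarrow>
     (real \<Rightarrow> (real \<Rightarrow> 'a) \<Rightarrow> (real \<Rightarrow> 'b)) \<Rightarrow> bool" where
  "unif_bounded_linear_ops \<Delta> T A nA B nB L \<longleftrightarrow>
     (\<forall>\<delta>\<in>\<Delta>. linear_class_map T A B (L \<delta>)) \<and> (\<exists>C. \<forall>\<delta>\<in>\<Delta>. \<forall>x\<in>A. nB (L \<delta> x) \<le> C * nA x)"

text \<open>
  Equality of operators; it serves to say that the leading-order operator changes with the particle
  size only if one of the operators it is built from does.
\<close>

definition same_op ::
    "real \<Rightarrow> (real \<Rightarrow> 'a) set \<Rightarrow> ((real \<Rightarrow> 'a) \<Rightarrow> (real \<Rightarrow> 'b)) \<Rightarrow> ((real \<Rightarrow> 'a) \<Rightarrow> (real \<Rightarrow> 'b)) \<Rightarrow> bool" where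
  "same_op T A L L' \<longleftrightarrow> (\<forall>x\<in>A. ae_eq T (L x) (L' x))"

definition dense_subspace ::
    "(real \<Rightarrow> 'a::real_vector) set \<Rightarrow> ((real \<Rightarrow> 'a) \<Rightarrow> real) \<Rightarrow> (real \<Rightarrow> 'a) set \<Rightarrow> bool" where
  "dense_subspace A nA A0 \<longleftrightarrow> A0 \<subseteq> A \<and> (\<lambda>_. 0) \<in> A0 \<and>
     (\<forall>x\<in>A0. \<forall>y\<in>A0. \<forall>a b. (\<lambda>t. a *\<^sub>R x t + b *\<^sub>R y t) \<in> A0) \<and>
     (\<forall>x\<in>A. \<forall>e>0. \<exists>y\<in>A0. nA (\<lambda>t. x t - y t) < e)"

section \<open>Geometry of the particles\<close>

text \<open>\<open>C\<^sup>2\<close> boundary: locally the domain is the sublevel set of a \<open>C\<^sup>2\<close> function without critical points.\<close>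

definition C2_domain :: "(real ^ 3) set \<Rightarrow> bool" where
  "C2_domain B \<longleftrightarrow> open B \<and> bounded B \<and> B \<noteq> {} \<and>
     (\<forall>x\<in>frontier B. \<exists>W \<psi>. open W \<and> x \<in> W \<and> Ck 2 \<psi> \<and>
        (\<forall>y\<in>W. \<exists>b\<in>Basis. dir_deriv b \<psi> y \<noteq> 0) \<and> B \<inter> W = {y \<in> W. \<psi> y < 0})"

definition particle :: "real ^ 3 \<Rightarrow> (real ^ 3) set \<Rightarrow> real \<Rightarrow> (real ^ 3) set" where
  "particle z B \<delta> = (\<lambda>y. z + \<delta> *\<^sub>R y) ` B"

definition admissible_particles ::
    "real set \<Rightarrow> ('m::finite \<Rightarrow> real ^ 3) \<Rightarrow> ('m \<Rightarrow> (real ^ 3) set) \<Rightarrow> bool" where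
  "admissible_particles \<Delta> z B \<longleftrightarrow> inj z \<and> (\<forall>i. C2_domain (B i)) \<and>
     (\<forall>\<delta>\<in>\<Delta>. \<forall>i j. i \<noteq> j \<longrightarrow>
        closure (particle (z i) (B i) \<delta>) \<inter> closure (particle (z j) (B j) \<delta>) = {})"

section \<open>Electromagnetic scattering\<close>

definition ccross :: "complex ^ 3 \<Rightarrow> complex ^ 3 \<Rightarrow> complex ^ 3" where
  "ccross a b = vector [a $ 2 * b $ 3 - a $ 3 * b $ 2, a $ 3 * b $ 1 - a $ 1 * b $ 3,
                        a $ 1 * b $ 2 - a $ 2 * b $ 1]"

definition cvec :: "real ^ 3 \<Rightarrow> complex ^ 3" where
  "cvec v = (\<chi> k. complex_of_real (v $ k))"

definition L2_loc :: "(real ^ 3 \<Rightarrow> complex ^ 3) set" where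
  "L2_loc = {E. \<forall>K. compact K \<longrightarrow> E \<in> L2_space K}"

text \<open>\<open>curl E = W\<close> in the sense of distributions: \<open>\<integral> \<phi> W = \<integral> E \<times> \<nabla>\<phi>\<close> for all test functions \<open>\<phi>\<close>.\<close>

definition weak_curl :: "(real ^ 3 \<Rightarrow> complex ^ 3) \<Rightarrow> (real ^ 3 \<Rightarrow> complex ^ 3) \<Rightarrow> bool" where
  "weak_curl E W \<longleftrightarrow> (\<forall>\<phi>\<in>test_functions UNIV.
     (LINT x|lebesgue. \<phi> x *\<^sub>R W x)
       = (LINT x|lebesgue. ccross (E x) (cvec (\<chi> k. dir_deriv (axis k 1) \<phi> x))))"

text \<open>
  Time-harmonic Maxwell system with time dependence \<open>exp (-i\<omega>t)\<close>: the incident field solves the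
  background equations, the total field the equations with the coefficients \<open>\<epsilon>\<close> and \<open>\<mu>\<close> of the
  configuration, and the scattered field satisfies the Silver--Mueller radiation condition.
\<close>

definition maxwell_scattering ::
    "real \<Rightarrow> real \<Rightarrow> real \<Rightarrow> (real ^ 3 \<Rightarrow> complex) \<Rightarrow> (real ^ 3 \<Rightarrow> complex) \<Rightarrow>
     (real ^ 3 \<Rightarrow> complex ^ 3) \<Rightarrow> (real ^ 3 \<Rightarrow> complex ^ 3) \<Rightarrow>
     (real ^ 3 \<Rightarrow> complex ^ 3) \<Rightarrow> (real ^ 3 \<Rightarrow> complex ^ 3) \<Rightarrow> bool" where
  "maxwell_scattering \<omega> \<epsilon>m \<mu>m \<epsilon> \<mu> Ein Hin E H \<longleftrightarrow>
     Ein \<in> L2_loc \<and> Hin \<in> L2_loc \<and> E \<in> L2_loc \<and> H \<in> L2_loc \<and>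
     weak_curl Ein (\<lambda>x. (\<i> * complex_of_real (\<omega> * \<mu>m)) *s Hin x) \<and>
     weak_curl Hin (\<lambda>x. (- \<i> * complex_of_real (\<omega> * \<epsilon>m)) *s Ein x) \<and>
     weak_curl E (\<lambda>x. (\<i> * complex_of_real \<omega> * \<mu> x) *s H x) \<and>
     weak_curl H (\<lambda>x. (- \<i> * complex_of_real \<omega> * \<epsilon> x) *s E x) \<and>
     ((\<lambda>x. norm x *\<^sub>R (sqrt \<mu>m *\<^sub>R ccross (H x - Hin x) (cvec (x /\<^sub>R norm x))
                      - sqrt \<epsilon>m *\<^sub>R (E x - Ein x))) \<longlongrightarrow> 0) at_infinity"

text \<open>A material coefficient with constant background value outside the particles, of which \<open>D\<close> is the union.\<close>

definition material_coefficient :: "(real ^ 3) set \<Rightarrow> real \<Rightarrow> (real ^ 3 \<Rightarrow> complex) \<Rightarrow> bool" where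
  "material_coefficient D am a \<longleftrightarrow> a \<in> borel_measurable lebesgue \<and> bounded (range a) \<and>
     (\<forall>x. x \<notin> D \<longrightarrow> a x = complex_of_real am)"

text \<open>
  Internal energy \<open>|E|\<^sup>2\<close> in a particle \<open>D\<close>, extended by zero.  The \<open>l\<close>-th illumination pattern produces
  the total field \<open>E l\<close>, and its intensity enters with the time-dependent weight \<open>p\<^sub>l\<close>.
\<close>

definition internal_energy ::
    "(real ^ 3) set \<Rightarrow> ('p::finite \<Rightarrow> real ^ 3 \<Rightarrow> complex ^ 3) \<Rightarrow> (real \<Rightarrow> real ^ 'p) \<Rightarrow>
     real \<Rightarrow> real ^ 3 \<Rightarrow> real" where
  "internal_energy D E p = (\<lambda>t x. if x \<in> D then (\<Sum>l\<in>UNIV. p t $ l * (norm (E l x))\<^sup>2) else 0)"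

text \<open>The forcing term of the \<open>i\<close>-th particle is obtained from its internal energy by a map \<open>\<Lambda> i\<close>.\<close>

definition forcing ::
    "('m::finite \<Rightarrow> (real \<Rightarrow> real ^ 3 \<Rightarrow> real) \<Rightarrow> real \<Rightarrow> real) \<Rightarrow> ('m \<Rightarrow> (real ^ 3) set) \<Rightarrow>
     ('p::finite \<Rightarrow> real ^ 3 \<Rightarrow> complex ^ 3) \<Rightarrow> (real \<Rightarrow> real ^ 'p) \<Rightarrow> real \<Rightarrow> real ^ 'm" where
  "forcing \<Lambda> D E p = (\<lambda>t. \<chi> i. \<Lambda> i (internal_energy (D i) E p) t)"

text \<open>
  Linearity of \<open>\<Lambda>\<close> is required on the energies that actually occur only: integral functionals are
  not linear on functions that fail to be integrable.
\<close>

definition linear_on_energies ::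
    "real \<Rightarrow> (real \<Rightarrow> real ^ 'p::finite) set \<Rightarrow> (real ^ 3) set \<Rightarrow> ('p \<Rightarrow> real ^ 3 \<Rightarrow> complex ^ 3) \<Rightarrow>
     ((real \<Rightarrow> real ^ 3 \<Rightarrow> real) \<Rightarrow> real \<Rightarrow> real) \<Rightarrow> bool" where
  "linear_on_energies T A D E \<Lambda> \<longleftrightarrow>
     (\<forall>u\<in>internal_energy D E ` A. \<forall>v\<in>internal_energy D E ` A. \<forall>a b.
        ae_eq T (\<Lambda> (\<lambda>t x. a * u t x + b * v t x)) (\<lambda>t. a * \<Lambda> u t + b * \<Lambda> v t))"

section \<open>The Volterra system\<close>

definition heat_kernel :: "real \<Rightarrow> real ^ 3 \<Rightarrow> real \<Rightarrow> real ^ 3 \<Rightarrow> real \<Rightarrow> real" where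
  "heat_kernel \<kappa> x t y \<tau> =
     (if t - \<tau> > 0
      then (4 * pi * \<kappa> * (t - \<tau>)) powr (- 3 / 2) * exp (- (norm (x - y))\<^sup>2 / (4 * \<kappa> * (t - \<tau>)))
      else 0)"

text \<open>The system with right-hand side \<open>f\<close>, for almost every time in \<open>(0,T)\<close>.\<close>

definition volterra_system ::
    "real \<Rightarrow> real \<Rightarrow> ('m::finite \<Rightarrow> real ^ 3) \<Rightarrow> ('m \<Rightarrow> 'm \<Rightarrow> real) \<Rightarrow>
     (real \<Rightarrow> real ^ 'm) \<Rightarrow> (real \<Rightarrow> real ^ 'm) \<Rightarrow> bool" where
  "volterra_system T \<kappa> z \<beta> \<sigma> f \<longleftrightarrow>
     (AE t in lebesgue_on {0<..<T}. \<forall>i.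
        \<sigma> t $ i + (\<Sum>j\<in>UNIV - {i}. \<beta> i j *
          (LINT \<tau>:{0..t}|lebesgue. deriv (\<lambda>s. heat_kernel \<kappa> (z i) s (z j) \<tau>) t * \<sigma> \<tau> $ j))
        = f t $ i)"

text \<open>\<open>\<V>\<close> is the operator defined by the system: \<open>\<V> F\<close> is its unique solution with right-hand side \<open>F\<close>.\<close>

definition volterra_solution_operator ::
    "real \<Rightarrow> real \<Rightarrow> ('m::finite \<Rightarrow> real ^ 3) \<Rightarrow> ('m \<Rightarrow> 'm \<Rightarrow> real) \<Rightarrow>
     ((real \<Rightarrow> real ^ 'm) \<Rightarrow> (real \<Rightarrow> real ^ 'm)) \<Rightarrow> bool" where
  "volterra_solution_operator T \<kappa> z \<beta> \<V> \<longleftrightarrow>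
     (\<forall>F\<in>H1_vec T. \<forall>\<sigma>\<in>H1_vec T. volterra_system T \<kappa> z \<beta> \<sigma> F \<longleftrightarrow> ae_eq T \<sigma> (\<V> F))"

definition heat_input :: "real \<Rightarrow> ('m::finite \<Rightarrow> real) \<Rightarrow> (real \<Rightarrow> real ^ 'm) \<Rightarrow> real \<Rightarrow> real ^ 'm" where
  "heat_input c \<alpha> \<sigma> = (\<lambda>t. \<chi> i. \<alpha> i / c * \<sigma> t $ i)"

end

theory Submission
  imports Defs
begin

section \<open>Almost-everywhere classes and operators between them\<close>

lemma ae_eq_sym: "ae_eq T f g \<Longrightarrow> ae_eq T g f"
  unfolding ae_eq_def by (simp add: eq_commute)

lemma ae_eq_trans [trans]: "ae_eq T f g \<Longrightarrow> ae_eq T g h \<Longrightarrow> ae_eq T f h"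
  unfolding ae_eq_def by (rule AE_mp, assumption) (auto elim: eventually_mono)

lemma ae_eq_add:
  "ae_eq T f f' \<Longrightarrow> ae_eq T g g' \<Longrightarrow> ae_eq T (\<lambda>t. f t + g t) (\<lambda>t. f' t + g' t)"
  unfolding ae_eq_def by (rule AE_mp, assumption) (auto elim: eventually_mono)

lemma ae_eq_comp: "ae_eq T f g \<Longrightarrow> ae_eq T (\<lambda>t. h (f t)) (\<lambda>t. h (g t))"
  unfolding ae_eq_def by (auto elim: eventually_mono)

text \<open>Apart from the empty set, these are the full preimages of linear subspaces under the
  passage to almost-everywhere classes. Saturation under \<open>ae_eq\<close> allows membership to
  be read off from an almost-everywhere identity.\<close>

definition ae_closed_subspace :: "real \<Rightarrow> (real \<Rightarrow> 'a::real_vector) set \<Rightarrow> bool" where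
  "ae_closed_subspace T A \<longleftrightarrow>
     (\<forall>x\<in>A. \<forall>y. ae_eq T x y \<longrightarrow> y \<in> A) \<and>
     (\<forall>x\<in>A. \<forall>y\<in>A. (\<lambda>t. x t + y t) \<in> A) \<and> (\<forall>c. \<forall>x\<in>A. (\<lambda>t. c *\<^sub>R x t) \<in> A)"

lemma class_map_comp:
  "class_map T A B L \<Longrightarrow> class_map T B C M \<Longrightarrow> class_map T A C (\<lambda>x. M (L x))"
  unfolding class_map_def by blast

text \<open>
  The domain \<open>A\<close> need not be known to be a subspace: the image under \<open>L\<close> of a sum lies in \<open>B\<close>
  because it agrees almost everywhere with a sum of elements of \<open>B\<close>.
\<close>

lemma linear_class_map_comp:
  assumes L: "linear_class_map T A B L" and M: "linear_class_map T B C M"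
    and B: "ae_closed_subspace T B"
  shows "linear_class_map T A C (\<lambda>x. M (L x))"
proof -
  have LB: "L x \<in> B" if "x \<in> A" for x
    using L that by (simp add: linear_class_map_def class_map_def)
  \<comment> \<open>Membership in \<open>B\<close> is asked of \<open>x\<close> only, and saturation
    of \<open>B\<close> passes it on to \<open>y\<close>. Below, \<open>y\<close> is the image of a
    sum or multiple that is not known to lie in \<open>A\<close>.\<close>
  have M_cong: "ae_eq T (M y) (M x)" if "x \<in> B" "ae_eq T y x" for x y
    using M B that ae_eq_sym[OF that(2)]
    unfolding linear_class_map_def class_map_def ae_closed_subspace_def by blast
  have "ae_eq T (M (L (\<lambda>t. x t + y t))) (\<lambda>t. M (L x) t + M (L y) t)"
    if "x \<in> A" "y \<in> A" for x y
  proof -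
    have "ae_eq T (M (L (\<lambda>t. x t + y t))) (M (\<lambda>t. L x t + L y t))"
      using L B LB that by (intro M_cong) (auto simp: linear_class_map_def ae_closed_subspace_def)
    also have "ae_eq T \<dots> (\<lambda>t. M (L x) t + M (L y) t)"
      using M LB that by (auto simp: linear_class_map_def)
    finally show ?thesis .
  qed
  moreover have "ae_eq T (M (L (\<lambda>t. c *\<^sub>R x t))) (\<lambda>t. c *\<^sub>R M (L x) t)" if "x \<in> A" for c x
  proof -
    have "ae_eq T (M (L (\<lambda>t. c *\<^sub>R x t))) (M (\<lambda>t. c *\<^sub>R L x t))"
      using L B LB that by (intro M_cong) (auto simp: linear_class_map_def ae_closed_subspace_def)
    also have "ae_eq T \<dots> (\<lambda>t. c *\<^sub>R M (L x) t)"
      using M LB that by (auto simp: linear_class_map_def)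
    finally show ?thesis .
  qed
  moreover have "class_map T A C (\<lambda>x. M (L x))"
    using L M class_map_comp unfolding linear_class_map_def by blast
  ultimately show ?thesis
    by (simp add: linear_class_map_def)
qed

text \<open>The operator definitions leave the sign of the bounding constant open, while chaining
  estimates multiplies one bound by another constant. Since \<open>g\<close> is nonnegative on
  \<open>A\<close>, replacing \<open>C\<close> by its absolute value only weakens the bound.\<close>

lemma nonneg_bound_exI:
  fixes f g :: "'a \<Rightarrow> real"
  assumes "\<exists>C. \<forall>x\<in>A. f x \<le> C * g x" and "\<And>x. x \<in> A \<Longrightarrow> 0 \<le> g x"
  obtains C where "C \<ge> 0" and "\<And>x. x \<in> A \<Longrightarrow> f x \<le> C * g x"
proof -
  obtain C where C: "\<And>x. x \<in> A \<Longrightarrow> f x \<le> C * g x"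
    using assms(1) by blast
  show thesis
  proof (rule that)
    show "\<bar>C\<bar> \<ge> 0" by simp
    show "f x \<le> \<bar>C\<bar> * g x" if "x \<in> A" for x
      using C[OF that] mult_right_mono[OF abs_ge_self assms(2)[OF that]] by (rule order_trans)
  qed
qed

lemma bounded_linear_op_comp:
  assumes L: "bounded_linear_op T A nA B nB L" and M: "bounded_linear_op T B nB C nC M"
    and B: "ae_closed_subspace T B"
    and nA: "\<And>x. x \<in> A \<Longrightarrow> 0 \<le> nA x" and nB: "\<And>x. x \<in> B \<Longrightarrow> 0 \<le> nB x"
  shows "bounded_linear_op T A nA C nC (\<lambda>x. M (L x))"
proof -
  have LB: "L x \<in> B" if "x \<in> A" for x
    using L that by (simp add: bounded_linear_op_def linear_class_map_def class_map_def)
  obtain a where a: "\<And>x. x \<in> A \<Longrightarrow> nB (L x) \<le> a * nA x"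
    using L unfolding bounded_linear_op_def by blast
  \<comment> \<open>The sign of \<open>b\<close> matters because the bound for \<open>L\<close> is
    about to be multiplied by it.\<close>
  obtain b where b: "b \<ge> 0" "\<And>x. x \<in> B \<Longrightarrow> nC (M x) \<le> b * nB x"
    using nonneg_bound_exI[of B "\<lambda>x. nC (M x)" nB] M nB unfolding bounded_linear_op_def by blast
  have "nC (M (L x)) \<le> (b * a) * nA x" if "x \<in> A" for x
    using order_trans[OF b(2)[OF LB[OF that]] mult_left_mono[OF a[OF that] b(1)]]
    by (simp add: mult.assoc)
  then show ?thesis
    using linear_class_map_comp[OF _ _ B] L M unfolding bounded_linear_op_def by blast
qed

lemma unif_bounded_linear_ops_imp_bounded:
  "unif_bounded_linear_ops \<Delta> T A nA B nB L \<Longrightarrow> \<delta> \<in> \<Delta> \<Longrightarrow> bounded_linear_op T A nA B nB (L \<delta>)"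
  unfolding unif_bounded_linear_ops_def bounded_linear_op_def by blast

text \<open>The pair of size and argument is treated as one point of
  \<open>\<Delta> \<times> A\<close>. A single application of \<open>nonneg_bound_exI\<close> then
  gives a nonnegative constant without losing uniformity in \<delta>.\<close>

lemma unif_bounded_linear_ops_bound:
  assumes "unif_bounded_linear_ops \<Delta> T A nA B nB L" and "\<And>x. x \<in> A \<Longrightarrow> 0 \<le> nA x"
  obtains C where "C \<ge> 0" and "\<And>\<delta> x. \<delta> \<in> \<Delta> \<Longrightarrow> x \<in> A \<Longrightarrow> nB (L \<delta> x) \<le> C * nA x"
proof -
  have "\<exists>C. \<forall>y\<in>\<Delta> \<times> A. nB (L (fst y) (snd y)) \<le> C * nA (snd y)"
    using assms(1) unfolding unif_bounded_linear_ops_def by fastforce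
  then show thesis
  proof (rule nonneg_bound_exI)
    show "0 \<le> nA (snd y)" if "y \<in> \<Delta> \<times> A" for y
      using that assms(2) by auto
  next
    fix C assume "C \<ge> 0" and "\<And>y. y \<in> \<Delta> \<times> A \<Longrightarrow> nB (L (fst y) (snd y)) \<le> C * nA (snd y)"
    then show thesis using that[of C] by (metis SigmaI fst_conv snd_conv)
  qed
qed

text \<open>The intermediate term \<open>M (L' x)\<close> separates two changes: first the argument
  of \<open>M\<close>, harmless because \<open>M\<close> respects classes, then the operator itself
  at a point of \<open>B\<close>.\<close>

lemma same_op_comp:
  assumes "same_op T A L L'" and "same_op T B M M'"
    and "class_map T A B L" and "class_map T A B L'" and "class_map T B C M"
  shows "same_op T A (\<lambda>x. M (L x)) (\<lambda>x. M' (L' x))"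
  unfolding same_op_def
proof
  fix x assume x: "x \<in> A"
  have "ae_eq T (M (L x)) (M (L' x))"
    using assms x unfolding same_op_def class_map_def by blast
  also have "ae_eq T \<dots> (M' (L' x))"
    using assms x unfolding same_op_def class_map_def by blast
  finally show "ae_eq T (M (L x)) (M' (L' x))" .
qed

section \<open>Square-integrable functions\<close>

lemma L2_space_ae_cong:
  fixes f g :: "real \<Rightarrow> 'b::euclidean_space"
  assumes f: "f \<in> L2_space {0<..<T}" and eq: "ae_eq T f g"
  shows "g \<in> L2_space {0<..<T}"
proof -
  have fm: "f \<in> borel_measurable (lebesgue_on {0<..<T})"
    and fi: "integrable (lebesgue_on {0<..<T}) (\<lambda>x. (norm (f x))\<^sup>2)"
    using f by (auto simp: L2_space_def)
  have gm: "g \<in> borel_measurable (lebesgue_on {0<..<T})"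
  proof -
    \<comment> \<open>Extension by zero moves the question to the whole line, where completeness of
      Lebesgue measure carries measurability over to an almost everywhere equal function.\<close>
    have "AE x in lebesgue. (if x \<in> {0<..<T} then f x else 0) = (if x \<in> {0<..<T} then g x else 0)"
      using eq by (auto simp: ae_eq_def AE_restrict_space_iff elim!: eventually_mono)
    moreover have "(\<lambda>x. if x \<in> {0<..<T} then f x else 0) \<in> borel_measurable lebesgue"
      using fm by (rule borel_measurable_if_I) simp
    ultimately have "(\<lambda>x. if x \<in> {0<..<T} then g x else 0) \<in> borel_measurable lebesgue"
      by (rule borel_measurable_AE[rotated])
    then show ?thesis
      by (rule borel_measurable_if_D)
  qed
  then have "integrable (lebesgue_on {0<..<T}) (\<lambda>x. (norm (g x))\<^sup>2)"
    using eq fm fi unfolding ae_eq_def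
    by (subst integrable_cong_AE[of _ _ "\<lambda>x. (norm (f x))\<^sup>2"]) auto
  with gm show ?thesis by (simp add: L2_space_def)
qed

lemma L2_space_add:
  fixes f g :: "'a::euclidean_space \<Rightarrow> 'b::euclidean_space"
  assumes "f \<in> L2_space S" and "g \<in> L2_space S"
  shows "(\<lambda>x. f x + g x) \<in> L2_space S"
proof -
  have "integrable (lebesgue_on S) (\<lambda>x. (norm (f x + g x))\<^sup>2)"
  proof (rule Bochner_Integration.integrable_bound)
    show "integrable (lebesgue_on S) (\<lambda>x. 2 * (norm (f x))\<^sup>2 + 2 * (norm (g x))\<^sup>2)"
      using assms by (auto simp: L2_space_def)
    have "(norm (f x + g x))\<^sup>2 \<le> 2 * (norm (f x))\<^sup>2 + 2 * (norm (g x))\<^sup>2" for x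
    proof -
      have "(norm (f x + g x))\<^sup>2 \<le> (norm (f x) + norm (g x))\<^sup>2"
        by (intro power_mono norm_triangle_ineq) auto
      also have "\<dots> \<le> 2 * (norm (f x))\<^sup>2 + 2 * (norm (g x))\<^sup>2"
        using sum_squares_bound[of "norm (f x)" "norm (g x)"] by (simp add: power2_sum)
      finally show ?thesis .
    qed
    then show "AE x in lebesgue_on S. norm ((norm (f x + g x))\<^sup>2)
        \<le> norm (2 * (norm (f x))\<^sup>2 + 2 * (norm (g x))\<^sup>2)"
      by (simp add: order_trans[OF _ abs_ge_self])
  qed (use assms in \<open>auto simp: L2_space_def\<close>)
  then show ?thesis using assms by (auto simp: L2_space_def)
qed

lemma L2_space_scaleR:
  fixes f :: "'a::euclidean_space \<Rightarrow> 'b::euclidean_space"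
  shows "f \<in> L2_space S \<Longrightarrow> (\<lambda>x. c *\<^sub>R f x) \<in> L2_space S"
  by (auto simp: L2_space_def power_mult_distrib)

text \<open>This makes both pairings in \<open>weak_deriv\<close> genuine integrals, so that
  linearity of the integral applies to them. The domination is the inequality between arithmetic and
  geometric means.\<close>

lemma L2_space_mult_integrable:
  fixes f g :: "'a::euclidean_space \<Rightarrow> real"
  assumes "f \<in> L2_space S" and "g \<in> L2_space S"
  shows "integrable (lebesgue_on S) (\<lambda>x. f x * g x)"
proof (rule Bochner_Integration.integrable_bound)
  show "integrable (lebesgue_on S) (\<lambda>x. (f x)\<^sup>2 + (g x)\<^sup>2)"
    using assms by (auto simp: L2_space_def)
  have "\<bar>f x * g x\<bar> \<le> (f x)\<^sup>2 + (g x)\<^sup>2" for x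
    using sum_squares_bound[of "\<bar>f x\<bar>" "\<bar>g x\<bar>"] abs_ge_zero[of "f x * g x"]
    by (simp only: abs_mult power2_abs)
  then show "AE x in lebesgue_on S. norm (f x * g x) \<le> norm ((f x)\<^sup>2 + (g x)\<^sup>2)"
    by simp
qed (use assms in \<open>auto simp: L2_space_def\<close>)

lemma continuous_in_L2_space:
  fixes g :: "real \<Rightarrow> real"
  assumes "continuous_on UNIV g"
  shows "g \<in> L2_space {a<..<b}"
proof -
  \<comment> \<open>The closed interval comes first because compactness is what bounds a continuous
    function; restriction to the open interval follows.\<close>
  have "(\<lambda>x. (g x)\<^sup>2) absolutely_integrable_on {a..b}"
    using assms by (intro absolutely_integrable_continuous_real continuous_intros)
      (auto intro: continuous_on_subset)
  then have "(\<lambda>x. (g x)\<^sup>2) absolutely_integrable_on {a<..<b}"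
    by (rule set_integrable_subset) auto
  then have "integrable (lebesgue_on {a<..<b}) (\<lambda>x. (g x)\<^sup>2)"
    by (simp add: integrable_restrict_space set_integrable_def)
  moreover have "g \<in> borel_measurable (lebesgue_on {a<..<b})"
    using assms by (intro continuous_imp_measurable_on_sets_lebesgue)
      (auto intro: continuous_on_subset)
  ultimately show ?thesis by (simp add: L2_space_def)
qed

section \<open>Test functions, weak derivatives and the Sobolev space of order one\<close>

lemma dir_deriv_one [simp]: "dir_deriv 1 f = deriv f" for f :: "real \<Rightarrow> real"
proof
  fix x
  show "dir_deriv 1 f x = deriv f x"
    unfolding dir_deriv_def deriv_def
    using DERIV_shift[of f _ 0 x] by (simp add: add.commute)
qed

text \<open>The line has the single basis vector 1, so level one of \<open>Ck\<close> yields
  continuity of \<open>deriv \<phi>\<close>, just as level zero yields that of \<phi>. Continuous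
  functions on the line are square-integrable on bounded intervals.\<close>

lemma test_function_L2:
  assumes "\<phi> \<in> test_functions \<Omega>"
  shows "\<phi> \<in> L2_space {a<..<b}" and "deriv \<phi> \<in> L2_space {a<..<b}"
proof -
  have "Ck 0 \<phi>" "Ck (Suc 0) \<phi>"
    using assms by (auto simp: test_functions_def simp del: Ck.simps)
  then show "\<phi> \<in> L2_space {a<..<b}" "deriv \<phi> \<in> L2_space {a<..<b}"
    by (simp_all add: continuous_in_L2_space)
qed

lemma weak_deriv_ae_cong:
  assumes "weak_deriv T f f'" and "ae_eq T f g"
    and "f \<in> L2_space {0<..<T}"
  shows "weak_deriv T g f'"
  unfolding weak_deriv_def
proof
  fix \<phi> :: "real \<Rightarrow> real" assume \<phi>: "\<phi> \<in> test_functions {0<..<T}"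
  have "g \<in> L2_space {0<..<T}"
    using assms L2_space_ae_cong by blast
  \<comment> \<open>Comparing the integrals calls for measurability of both integrands; it is drawn
    from the integrability of products of square-integrable functions.\<close>
  with assms \<phi> have "(LINT t|lebesgue_on {0<..<T}. g t * deriv \<phi> t)
      = (LINT t|lebesgue_on {0<..<T}. f t * deriv \<phi> t)"
    by (intro integral_cong_AE borel_measurable_integrable L2_space_mult_integrable)
      (auto simp: ae_eq_def test_function_L2(2)[OF \<phi>] elim: eventually_mono)
  with assms(1) \<phi> show "(LINT t|lebesgue_on {0<..<T}. g t * deriv \<phi> t)
      = - (LINT t|lebesgue_on {0<..<T}. f' t * \<phi> t)"
    by (simp add: weak_deriv_def)
qed

text \<open>Square-integrability of all four functions makes every product with a test function
  integrable, so the integrals split. The Bochner integral, zero by default on non-integrable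
  functions, is not additive in general.\<close>

lemma weak_deriv_add:
  assumes "weak_deriv T f f'" and "weak_deriv T g g'"
    and "f \<in> L2_space {0<..<T}" "f' \<in> L2_space {0<..<T}"
    and "g \<in> L2_space {0<..<T}" "g' \<in> L2_space {0<..<T}"
  shows "weak_deriv T (\<lambda>t. f t + g t) (\<lambda>t. f' t + g' t)"
  using assms
  by (simp add: weak_deriv_def distrib_right Bochner_Integration.integral_add
      L2_space_mult_integrable test_function_L2)

text \<open>A constant factor leaves the integral even when that integral has its default value
  zero: a nonzero factor preserves non-integrability, and the factor zero makes both sides
  vanish.\<close>

lemma weak_deriv_scaleR:
  "weak_deriv T f f' \<Longrightarrow> weak_deriv T (\<lambda>t. c *\<^sub>R f t) (\<lambda>t. c *\<^sub>R f' t)"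
  by (simp add: weak_deriv_def mult.assoc)

lemma ae_closed_subspace_H1_space: "ae_closed_subspace T (H1_space T)"
  unfolding ae_closed_subspace_def
proof (intro conjI ballI allI impI)
  fix x y assume "x \<in> H1_space T" "ae_eq T x y"
  then show "y \<in> H1_space T"
    unfolding H1_space_def using L2_space_ae_cong weak_deriv_ae_cong by blast
next
  fix x y assume "x \<in> H1_space T" "y \<in> H1_space T"
  then show "(\<lambda>t. x t + y t) \<in> H1_space T"
    unfolding H1_space_def using L2_space_add weak_deriv_add by blast
next
  fix c x assume "x \<in> H1_space T"
  then show "(\<lambda>t. c *\<^sub>R x t) \<in> H1_space T"
    unfolding H1_space_def using L2_space_scaleR weak_deriv_scaleR by blast
qed

text \<open>This qualifies \<open>H1_vec T\<close> as the intermediate space in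
  \<open>bounded_linear_op_comp\<close>. The scalar case is applied to each component, and
  \<open>ae_eq_comp\<close> with a coordinate projection passes almost-everywhere equality to
  components.\<close>

lemma ae_closed_subspace_H1_vec:
  "ae_closed_subspace T (H1_vec T :: (real \<Rightarrow> real ^ 'm::finite) set)"
  using ae_closed_subspace_H1_space[of T] ae_eq_comp
  unfolding ae_closed_subspace_def H1_vec_def by fastforce

section \<open>Signs of the norms and the heat-input map\<close>

lemma H1_vec_norm_nonneg: "0 \<le> H1_vec_norm T f"
  by (simp add: H1_vec_norm_def sum_nonneg)

lemma Hs_norm_nonneg: "0 \<le> Hs_norm s g"
  by (simp add: Hs_norm_def sum_nonneg)

text \<open>Membership in \<open>H0_space\<close> provides a causal extension, so the infimum runs
  over a nonempty set of nonnegative numbers; over the empty set it would carry no information on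
  the sign.\<close>

lemma H0_norm_nonneg: "f \<in> H0_space s w T \<Longrightarrow> 0 \<le> H0_norm s w T f"
  unfolding H0_norm_def H0_space_def by (auto intro: cINF_greatest Hs_norm_nonneg)

lemma heat_input_add:
  "heat_input c \<alpha> (\<lambda>t. x t + y t) = (\<lambda>t. heat_input c \<alpha> x t + heat_input c \<alpha> y t)"
  by (auto simp: heat_input_def vec_eq_iff distrib_left)

lemma heat_input_ae_cong: "ae_eq T x y \<Longrightarrow> ae_eq T (heat_input c \<alpha> x) (heat_input c \<alpha> y)"
  unfolding heat_input_def by (rule ae_eq_comp)

section \<open>Leading-order operator and remainder\<close>

theorem theorem6p2:
  fixes T c\<^sub>m \<gamma>\<^sub>m \<kappa>\<^sub>m s w \<omega> \<epsilon>\<^sub>m \<mu>\<^sub>m C\<^sub>T \<mu> :: real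
    and \<Delta> :: "real set"
    and z :: "'m::finite \<Rightarrow> real ^ 3"
    and B :: "'m \<Rightarrow> (real ^ 3) set"
    and \<gamma>\<^sub>p \<alpha> :: "real \<Rightarrow> 'm \<Rightarrow> real"
    and \<beta> :: "real \<Rightarrow> 'm \<Rightarrow> 'm \<Rightarrow> real"
    and perm perb :: "real \<Rightarrow> real ^ 3 \<Rightarrow> complex"
    and Ein Hin :: "'p::finite \<Rightarrow> real ^ 3 \<Rightarrow> complex ^ 3"
    and E H :: "real \<Rightarrow> 'p \<Rightarrow> real ^ 3 \<Rightarrow> complex ^ 3"
    and \<Lambda> :: "real \<Rightarrow> 'm \<Rightarrow> (real \<Rightarrow> real ^ 3 \<Rightarrow> real) \<Rightarrow> real \<Rightarrow> real"
    and U\<^sub>0 :: "(real \<Rightarrow> real ^ 'p) set"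
    and F \<sigma> \<rho> r G :: "real \<Rightarrow> (real \<Rightarrow> real ^ 'p) \<Rightarrow> real \<Rightarrow> real ^ 'm"
    and \<T> :: "real \<Rightarrow> (real \<Rightarrow> real ^ 'p) \<Rightarrow> real \<Rightarrow> real ^ 'm"
    and \<V> \<S> :: "real \<Rightarrow> (real \<Rightarrow> real ^ 'm) \<Rightarrow> real \<Rightarrow> real ^ 'm"
  defines "U \<equiv> H0_space (s + 1 / 2) w T" and "normU \<equiv> H0_norm (s + 1 / 2) w T"
    and "X \<equiv> H1_vec T" and "normX \<equiv> H1_vec_norm T"
    and "Y \<equiv> L2_space {0<..<T}" and "normY \<equiv> L2_space_norm {0<..<T}"
  assumes "T > 0" and "s \<ge> 0" and "w > 0" and "\<Delta> \<subseteq> {0<..}"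
    and "c\<^sub>m > 0" and "\<gamma>\<^sub>m > 0" and "\<kappa>\<^sub>m > 0" and "\<omega> > 0" and "\<epsilon>\<^sub>m > 0" and "\<mu>\<^sub>m > 0"
    and "admissible_particles \<Delta> z B"
    and contrast: "\<And>\<delta> i. \<delta> \<in> \<Delta> \<Longrightarrow> \<gamma>\<^sub>p \<delta> i > 0 \<and> \<alpha> \<delta> i = \<gamma>\<^sub>p \<delta> i - \<gamma>\<^sub>m"
    and maxwell: "\<And>\<delta>. \<delta> \<in> \<Delta> \<Longrightarrow>
          material_coefficient (\<Union>i. particle (z i) (B i) \<delta>) \<epsilon>\<^sub>m (perm \<delta>) \<and>
          material_coefficient (\<Union>i. particle (z i) (B i) \<delta>) \<mu>\<^sub>m (perb \<delta>) \<and>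
          (\<forall>l. maxwell_scattering \<omega> \<epsilon>\<^sub>m \<mu>\<^sub>m (perm \<delta>) (perb \<delta>) (Ein l) (Hin l) (E \<delta> l) (H \<delta> l))"
    and U0_dense: "dense_subspace U normU U\<^sub>0"
    and forcing_linear: "\<And>\<delta> i. \<delta> \<in> \<Delta> \<Longrightarrow>
          linear_on_energies T U\<^sub>0 (particle (z i) (B i) \<delta>) (E \<delta>) (\<Lambda> \<delta> i)"
    \<comment> \<open>(i): the forcing vector for a general control is the value of the extension\<close>
    and T_op: "unif_bounded_linear_ops \<Delta> T U normU X normX \<T>"
    and T_extends: "\<And>\<delta> p. \<delta> \<in> \<Delta> \<Longrightarrow> p \<in> U\<^sub>0 \<Longrightarrow>
          ae_eq T (\<T> \<delta> p) (forcing (\<Lambda> \<delta>) (\<lambda>i. particle (z i) (B i) \<delta>) (E \<delta>) p)"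
    and F_def: "\<And>\<delta> p. \<delta> \<in> \<Delta> \<Longrightarrow> p \<in> U \<Longrightarrow> F \<delta> p = \<T> \<delta> p"
    \<comment> \<open>(ii)\<close>
    and V_op: "\<And>\<delta>. \<delta> \<in> \<Delta> \<Longrightarrow> bounded_linear_op T X normX X normX (\<V> \<delta>)"
    and V_solves: "\<And>\<delta>. \<delta> \<in> \<Delta> \<Longrightarrow> volterra_solution_operator T \<kappa>\<^sub>m z (\<beta> \<delta>) (\<V> \<delta>)"
    and \<sigma>_map: "\<And>\<delta>. \<delta> \<in> \<Delta> \<Longrightarrow> class_map T U X (\<sigma> \<delta>)"
    and \<sigma>_volterra: "\<And>\<delta> p. \<delta> \<in> \<Delta> \<Longrightarrow> p \<in> U \<Longrightarrow>
          volterra_system T \<kappa>\<^sub>m z (\<beta> \<delta>) (\<sigma> \<delta> p) (\<lambda>t. F \<delta> p t + \<rho> \<delta> p t)"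
    and \<sigma>_eq: "\<And>\<delta> p. \<delta> \<in> \<Delta> \<Longrightarrow> p \<in> U \<Longrightarrow> ae_eq T (\<sigma> \<delta> p) (\<lambda>t. \<V> \<delta> (F \<delta> p) t + r \<delta> p t)"
    and r_map: "\<And>\<delta>. \<delta> \<in> \<Delta> \<Longrightarrow> class_map T U X (r \<delta>)"
    and "\<mu> > 0" and "C\<^sub>T > 0"
    and r_bound: "\<And>\<delta> p. \<delta> \<in> \<Delta> \<Longrightarrow> p \<in> U \<Longrightarrow>
          normX (r \<delta> p) \<le> C\<^sub>T * real CARD('m) * \<delta> powr \<mu> * normX (F \<delta> p)"
    \<comment> \<open>(iii)\<close>
    and S_op: "unif_bounded_linear_ops \<Delta> T X normX Y normY \<S>"
    and S_extends: "\<And>\<delta> x. \<delta> \<in> \<Delta> \<Longrightarrow> x \<in> X \<Longrightarrow> ae_eq T (\<S> \<delta> x) (heat_input c\<^sub>m (\<alpha> \<delta>) x)"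
    and G_def: "\<And>\<delta> p. \<delta> \<in> \<Delta> \<Longrightarrow> p \<in> U \<Longrightarrow> G \<delta> p = heat_input c\<^sub>m (\<alpha> \<delta>) (\<sigma> \<delta> p)"
  shows "\<exists>(\<K> :: real \<Rightarrow> (real \<Rightarrow> real ^ 'p) \<Rightarrow> real \<Rightarrow> real ^ 'm)
            (\<R> :: real \<Rightarrow> (real \<Rightarrow> real ^ 'p) \<Rightarrow> real \<Rightarrow> real ^ 'm) C'.
     C' > 0 \<and>
     (\<forall>\<delta>\<in>\<Delta>. bounded_linear_op T U normU Y normY (\<K> \<delta>)) \<and>
     (\<forall>\<delta>\<in>\<Delta>. \<forall>\<delta>'\<in>\<Delta>.
        same_op T U (\<T> \<delta>) (\<T> \<delta>') \<and> same_op T X (\<V> \<delta>) (\<V> \<delta>') \<and> same_op T X (\<S> \<delta>) (\<S> \<delta>')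
          \<longrightarrow> same_op T U (\<K> \<delta>) (\<K> \<delta>')) \<and>
     (\<forall>\<delta>\<in>\<Delta>. class_map T U Y (\<R> \<delta>)) \<and>
     (\<forall>\<delta>\<in>\<Delta>. \<forall>p\<in>U.
        ae_eq T (G \<delta> p) (\<lambda>t. \<K> \<delta> p t + \<R> \<delta> p t) \<and>
        normY (\<R> \<delta> p) \<le> C' * real CARD('m) * \<delta> powr \<mu> * normU p)"
proof -
  have nU: "0 \<le> normU p" if "p \<in> U" for p
    using that by (simp add: U_def normU_def H0_norm_nonneg)
  have nX: "0 \<le> normX x" for x
    by (simp add: normX_def H1_vec_norm_nonneg)
  have X: "ae_closed_subspace T X"
    by (simp add: X_def ae_closed_subspace_H1_vec)
  note bT = unif_bounded_linear_ops_imp_bounded[OF T_op]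
  note bS = unif_bounded_linear_ops_imp_bounded[OF S_op]
  have cT: "class_map T U X (\<T> \<delta>)" if "\<delta> \<in> \<Delta>" for \<delta>
    using bT[OF that] by (simp add: bounded_linear_op_def linear_class_map_def)
  have cV: "class_map T X X (\<V> \<delta>)" if "\<delta> \<in> \<Delta>" for \<delta>
    using V_op[OF that] by (simp add: bounded_linear_op_def linear_class_map_def)
  have cS: "class_map T X Y (\<S> \<delta>)" if "\<delta> \<in> \<Delta>" for \<delta>
    using bS[OF that] by (simp add: bounded_linear_op_def linear_class_map_def)
  obtain a where a: "a \<ge> 0" "\<And>\<delta> p. \<delta> \<in> \<Delta> \<Longrightarrow> p \<in> U \<Longrightarrow> normX (\<T> \<delta> p) \<le> a * normU p"
    using unif_bounded_linear_ops_bound[OF T_op nU] by metis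
  obtain b where b: "b \<ge> 0" "\<And>\<delta> x. \<delta> \<in> \<Delta> \<Longrightarrow> x \<in> X \<Longrightarrow> normY (\<S> \<delta> x) \<le> b * normX x"
    using unif_bounded_linear_ops_bound[OF S_op nX] by metis
  \<comment> \<open>The product is the chain of bounds for \<open>\<S>\<close>, the remainder and
    \<open>\<T>\<close>, all uniform in \<delta>; \<open>\<V>\<close> is assumed bounded for each
    \<delta> separately. The summand 1 secures strict positivity when \<open>a\<close> or
    \<open>b\<close> is zero.\<close>
  define C' where "C' = b * C\<^sub>T * a + 1"
  \<comment> \<open>\<open>\<S>\<close> takes the place of \<open>heat_input\<close> because
    boundedness into \<open>Y\<close> is known for \<open>\<S>\<close>; the two agree almost
    everywhere on \<open>X\<close>.\<close>
  define \<K> where "\<K> = (\<lambda>\<delta> p. \<S> \<delta> (\<V> \<delta> (\<T> \<delta> p)))"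
  \<comment> \<open>The remainder \<open>r\<close> is already an error of the amplitudes, hence it
    passes through \<open>\<S>\<close> alone. Like \<open>r\<close>, this map is only claimed to
    respect classes, not to be linear.\<close>
  define \<R> where "\<R> = (\<lambda>\<delta> p. \<S> \<delta> (r \<delta> p))"
  have "C' > 0"
    using a b \<open>C\<^sub>T > 0\<close> by (simp add: C'_def add_nonneg_pos)
  moreover have "bounded_linear_op T U normU Y normY (\<K> \<delta>)" if "\<delta> \<in> \<Delta>" for \<delta>
    unfolding \<K>_def
    by (intro bounded_linear_op_comp[OF bounded_linear_op_comp[OF bT V_op] bS] that X nU nX)
  moreover have "same_op T U (\<K> \<delta>) (\<K> \<delta>')"
    if d: "\<delta> \<in> \<Delta>" "\<delta>' \<in> \<Delta>" and eq: "same_op T U (\<T> \<delta>) (\<T> \<delta>')" "same_op T X (\<V> \<delta>) (\<V> \<delta>')"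
      "same_op T X (\<S> \<delta>) (\<S> \<delta>')" for \<delta> \<delta>'
  proof -
    have "same_op T U (\<lambda>p. \<V> \<delta> (\<T> \<delta> p)) (\<lambda>p. \<V> \<delta>' (\<T> \<delta>' p))"
      using eq(1,2) cT[OF d(1)] cT[OF d(2)] cV[OF d(1)] by (rule same_op_comp)
    then show ?thesis
      unfolding \<K>_def using eq(3) class_map_comp[OF cT cV, OF d(1) d(1)]
        class_map_comp[OF cT cV, OF d(2) d(2)] cS[OF d(1)] by (rule same_op_comp)
  qed
  moreover have "class_map T U Y (\<R> \<delta>)" if "\<delta> \<in> \<Delta>" for \<delta>
    unfolding \<R>_def by (intro class_map_comp[OF r_map cS] that)
  moreover have "ae_eq T (G \<delta> p) (\<lambda>t. \<K> \<delta> p t + \<R> \<delta> p t)" if d: "\<delta> \<in> \<Delta>" and p: "p \<in> U" for \<delta> p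
  proof -
    have VT: "\<V> \<delta> (\<T> \<delta> p) \<in> X" and rX: "r \<delta> p \<in> X"
      using cT[OF d] cV[OF d] r_map[OF d] p by (auto simp: class_map_def)
    \<comment> \<open>The splitting is done on \<open>heat_input\<close>, whose additivity is an
      exact pointwise identity. Only afterwards is \<open>\<S>\<close> substituted in each summand,
      which takes membership of both arguments in \<open>X\<close>.\<close>
    have "ae_eq T (G \<delta> p) (\<lambda>t. heat_input c\<^sub>m (\<alpha> \<delta>) (\<V> \<delta> (\<T> \<delta> p)) t + heat_input c\<^sub>m (\<alpha> \<delta>) (r \<delta> p) t)"
      using heat_input_ae_cong[OF \<sigma>_eq[OF d p], of c\<^sub>m "\<alpha> \<delta>"] d p
      by (simp add: heat_input_add F_def G_def)
    also have "ae_eq T \<dots> (\<lambda>t. \<K> \<delta> p t + \<R> \<delta> p t)"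
      unfolding \<K>_def \<R>_def
      by (intro ae_eq_add ae_eq_sym[OF S_extends] d VT rX)
    finally show ?thesis .
  qed
  moreover have "normY (\<R> \<delta> p) \<le> C' * real CARD('m) * \<delta> powr \<mu> * normU p"
    if d: "\<delta> \<in> \<Delta>" and p: "p \<in> U" for \<delta> p
  proof -
    let ?N = "real CARD('m) * \<delta> powr \<mu>"
    have "r \<delta> p \<in> X"
      using r_map[OF d] p by (auto simp: class_map_def)
    then have "normY (\<R> \<delta> p) \<le> b * normX (r \<delta> p)"
      unfolding \<R>_def using b d by blast
    \<comment> \<open>The remainder is controlled relative to the forcing, and \<open>F_def\<close>
      identifies the forcing with \<open>\<T> \<delta> p\<close>. All dependence on \<delta> stays
      in the factor \<open>?N\<close>.\<close>
    also have "\<dots> \<le> b * (C\<^sub>T * ?N * normX (\<T> \<delta> p))"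
      using r_bound[OF d p] F_def[OF d p] b by (intro mult_left_mono) (auto simp: mult.assoc)
    also have "\<dots> \<le> b * (C\<^sub>T * ?N * (a * normU p))"
      using a b \<open>C\<^sub>T > 0\<close> d p by (intro mult_left_mono) auto
    also have "\<dots> = (b * C\<^sub>T * a) * (?N * normU p)"
      by (simp add: algebra_simps)
    also have "\<dots> \<le> C' * (?N * normU p)"
      using nU[OF p] by (intro mult_right_mono) (auto simp: C'_def)
    finally show ?thesis
      by (simp add: mult.assoc)
  qed
  ultimately show ?thesis
    by (intro exI[of _ \<K>] exI[of _ \<R>] exI[of _ C']) blast
qed

end
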